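(* Let $A$ be a $3\times 3$ real matrix and consider the linear time-invariant system $\dot r(t)=Ar(t)$, $r(t)\in\mathbb{R}^3$. For a solution $r(t)=\mathrm{e}^{tA}r(0)$, let $\kappa(t)$ and $\tau(t)$ be the curvature and torsion of its trajectory, respectively. (1) If there exists a measurable set $E_1\subseteq\mathbb{R}^3$ whose Lebesgue measure is greater than $0$, such that for all $r(0)\in E_1$, $\lim_{t\to+\infty}\kappa(t)\neq 0$ or $\lim_{t\to+\infty}\kappa(t)$ does not exist, then the zero solution of the system is stable. (2) If $A$ is invertible, and there exists a measurable set $E_2\subseteq\mathbb{R}^3$ whose Lebesgue measure is greater than $0$, such that for all $r(0)\in E_2$, $\lim_{t\to+\infty}\kappa(t)=+\infty$, then the zero solution of the system is asymptotically stable. (3) If there exists a measurable set $E_3\subseteq\mathbb{R}^3$ whose Lebesgue measure is greater than $0$, such that for all $r(0)\in E_3$, $\lim_{t\to+\infty}\tau(t)\neq 0$ or $\lim_{t\to+\infty}\tau(t)$ does not exist, then the zero solution of the system is asymptotically stable.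
   Context: For a smooth curve $r:[0,+\infty)\to\mathbb{R}^3$, the curvature and torsion are $\kappa(t)=\frac{\|\dot r\times\ddot r\|}{\|\dot r\|^3}$ and $\tau(t)=\frac{(\dot r,\ddot r,\dddot r)}{\|\dot r\times\ddot r\|^2}$, where $(a,b,c)=(a\times b)\cdot c$ and $\|\cdot\|$ is the Euclidean norm. Conventions: if the trajectory is a constant point ($\dot r\equiv 0$), then $\kappa\equiv 0$ and $\tau\equiv 0$; if $\dot r\times\ddot r\equiv 0$, then $\tau\equiv 0$. (For solutions of $\dot r=Ar$, each of $\dot r$ and $\dot r\times\ddot r$ vanishes either identically or nowhere.) The conditions "limit $\neq 0$ or does not exist" mean that it is not the case that the quantity tends to $0$ as $t\to+\infty$. Stability: the zero solution of $\dot r=Ar$ is stable if for every $\varepsilon>0$ there is $\delta>0$ such that $\|r(0)\|<\delta$ implies $\|\mathrm{e}^{tA}r(0)\|<\varepsilon$ for all $t\ge 0$. It is asymptotically stable if it is stable and there is $\delta_1>0$ such that $\|r(0)\|<\delta_1$ implies $\lim_{t\to+\infty}\mathrm{e}^{tA}r(0)=0$. *)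

theory Defs
  imports "HOL-Analysis.Analysis"
begin

primrec mat_power :: "real^'n^'n \<Rightarrow> nat \<Rightarrow> real^'n^'n" where
  "mat_power A 0 = mat 1"
| "mat_power A (Suc k) = A ** mat_power A k"

(* The library's exp is not available here: the type real^'n^'n carries the componentwise
   product and is no normed algebra. *)
definition mat_exp :: "real^'n^'n \<Rightarrow> real^'n^'n" where
  "mat_exp A = (\<Sum>k. (1 / fact k) *\<^sub>R mat_power A k)"

definition trajectory :: "real^3^3 \<Rightarrow> real^3 \<Rightarrow> real \<Rightarrow> real^3" where
  "trajectory A r0 t = mat_exp (t *\<^sub>R A) *v r0"

(* Curves have domain [0, \<infinity>), so the derivative at 0 is one-sided. *)
definition curve_deriv :: "(real \<Rightarrow> real^3) \<Rightarrow> real \<Rightarrow> real^3" where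
  "curve_deriv r t = vector_derivative r (at t within {0..})"

(* As x / 0 = 0, the curvature and the torsion below are 0 wherever r' = 0, and the torsion
   is 0 wherever r' and r'' are parallel. These are the usual conventions for constant
   trajectories and for trajectories with r' and r'' everywhere parallel. *)
definition curvature :: "(real \<Rightarrow> real^3) \<Rightarrow> real \<Rightarrow> real" where
  "curvature r t =
     (let r1 = curve_deriv r; r2 = curve_deriv r1
      in norm (cross3 (r1 t) (r2 t)) / norm (r1 t) ^ 3)"

definition torsion :: "(real \<Rightarrow> real^3) \<Rightarrow> real \<Rightarrow> real" where
  "torsion r t =
     (let r1 = curve_deriv r; r2 = curve_deriv r1; r3 = curve_deriv r2
      in (cross3 (r1 t) (r2 t) \<bullet> r3 t) / (norm (cross3 (r1 t) (r2 t)))\<^sup>2)"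

definition zero_stable :: "real^3^3 \<Rightarrow> bool" where
  "zero_stable A \<longleftrightarrow>
     (\<forall>\<epsilon>>0. \<exists>\<delta>>0. \<forall>r0. norm r0 < \<delta> \<longrightarrow> (\<forall>t\<ge>0. norm (trajectory A r0 t) < \<epsilon>))"

definition zero_asymptotically_stable :: "real^3^3 \<Rightarrow> bool" where
  "zero_asymptotically_stable A \<longleftrightarrow>
     zero_stable A \<and>
     (\<exists>\<delta>>0. \<forall>r0. norm r0 < \<delta> \<longrightarrow> (trajectory A r0 \<longlongrightarrow> 0) at_top)"

end

(*
  Write v = Ar for the velocity, w = v x Av, T = tr A.

  Curvature is at most ||A|| / ||v||.  If it tends to infinity and A is invertible, then r tends to 0;
  the initial values with r -> 0 form a subspace, which is the whole space as it is not negligible.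
  An eigenvalue with positive real part forces ||v|| -> infinity off a hyperplane (pair v with a left
  eigenvector).  If there is none, the Cayley-Hamilton equation bounds all solutions, except when 0 is
  a double eigenvalue; then Av - cv is constant (c the third eigenvalue), and the curvature tends to 0
  for every r(0).

  The numerator of the torsion is D = w . AAv, and D' = T D.  For an eigenvector u = p + iq of A with
  eigenvalue z the function f = u . w satisfies f' = (T - z) f, and f does not vanish unless D does.
  Hence |torsion| = |D| / ||w||^2 is O(exp((2 Re z - T) t)).  So if the torsion of a single trajectory
  does not tend to 0, then det A is nonzero and 2 Re z >= T for every eigenvalue z; for three
  eigenvalues with sum T this forces all real parts to be negative.
*)
theory Submission
  imports Defs "HOL-Real_Asymp.Real_Asymp"
begin

unbundle cross3_syntax

section \<open>The matrix exponential and its trajectories\<close>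

lemma mat_power_Suc_vec: "mat_power A (Suc k) *v x = A *v (mat_power A k *v x)"
  by (simp add: matrix_vector_mul_assoc)

lemma mat_power_scaleR: "mat_power (t *\<^sub>R A) k = t ^ k *\<^sub>R mat_power A k"
  by (induction k) (simp_all add: matrix_scalar_ac flip: scalar_matrix_assoc)

lemma norm_mat_power_vec_le:
  fixes A :: "real^'n^'n"
  shows "norm (mat_power A k *v x) \<le> onorm ((*v) A) ^ k * norm x"
proof (induction k)
  case (Suc k)
  have "norm (mat_power A (Suc k) *v x) \<le> onorm ((*v) A) * norm (mat_power A k *v x)"
    unfolding mat_power_Suc_vec by (rule onorm) simp
  also have "\<dots> \<le> onorm ((*v) A) * (onorm ((*v) A) ^ k * norm x)"
    by (intro mult_left_mono Suc onorm_pos_le) simp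
  finally show ?case by (simp add: mult.assoc)
qed simp

lemma summable_mat_power_entry:
  fixes A :: "real^'n^'n"
  shows "summable (\<lambda>k. mat_power A k $ i $ j / fact k * t ^ k)"
proof (rule summable_comparison_test')
  let ?K = "onorm ((*v) A)"
  have e: "\<bar>mat_power A k $ i $ j\<bar> \<le> ?K ^ k" for k
  proof -
    have "\<bar>mat_power A k $ i $ j\<bar> = \<bar>(mat_power A k *v axis j 1) $ i\<bar>"
      by (simp add: matrix_vector_mul_component inner_axis' row_def inner_axis)
    also have "\<dots> \<le> norm (mat_power A k *v axis j 1)"
      by (rule component_le_norm_cart)
    also have "\<dots> \<le> ?K ^ k"
      using norm_mat_power_vec_le[of A k "axis j 1"] by simp
    finally show ?thesis .
  qed
  show "summable (\<lambda>k. (?K * \<bar>t\<bar>) ^ k /\<^sub>R fact k)"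
    by (rule summable_exp_generic)
  show "norm (mat_power A k $ i $ j / fact k * t ^ k) \<le> (?K * \<bar>t\<bar>) ^ k /\<^sub>R fact k" if "0 \<le> k" for k
    using mult_right_mono[OF e[of k], of "\<bar>t\<bar> ^ k / fact k"]
    by (simp add: abs_mult power_abs power_mult_distrib field_simps)
qed

lemma mat_exp_entry:
  fixes A :: "real^'n^'n"
  shows "mat_exp (t *\<^sub>R A) $ i $ j = (\<Sum>k. mat_power A k $ i $ j / fact k * t ^ k)"
proof -
  have "(\<lambda>k. (1 / fact k) *\<^sub>R mat_power (t *\<^sub>R A) k) sums
          (\<chi> i j. \<Sum>k. mat_power A k $ i $ j / fact k * t ^ k)"
    unfolding sums_def
  proof (intro vec_tendstoI)
    fix i j
    show "(\<lambda>n. (\<Sum>k<n. (1 / fact k) *\<^sub>R mat_power (t *\<^sub>R A) k) $ i $ j) \<longlonglongrightarrow>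
            (\<chi> i j. \<Sum>k. mat_power A k $ i $ j / fact k * t ^ k) $ i $ j"
      using summable_LIMSEQ[OF summable_mat_power_entry[of A i j t]]
      by (simp add: mat_power_scaleR mult.commute)
  qed
  then show ?thesis
    unfolding mat_exp_def by (simp add: sums_unique[symmetric])
qed

lemma mat_exp_entry_deriv:
  fixes A :: "real^'n^'n"
  shows "((\<lambda>t. mat_exp (t *\<^sub>R A) $ i $ j) has_real_derivative
           (A ** mat_exp (t *\<^sub>R A)) $ i $ j) (at t)"
proof -
  let ?c = "\<lambda>i k. mat_power A k $ i $ j / fact k"
  have "(\<Sum>n. diffs (?c i) n * t ^ n) = (\<Sum>n. \<Sum>l\<in>UNIV. A $ i $ l * (?c l n * t ^ n))"
    by (simp add: diffs_def matrix_matrix_mult_def sum_distrib_right sum_distrib_left sum_divide_distrib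
        mult.assoc del: of_nat_Suc)
  also have "\<dots> = (\<Sum>l\<in>UNIV. \<Sum>n. A $ i $ l * (?c l n * t ^ n))"
    by (intro suminf_sum summable_mult summable_mat_power_entry)
  also have "\<dots> = (A ** mat_exp (t *\<^sub>R A)) $ i $ j"
    by (simp only: matrix_matrix_mult_def vec_lambda_beta mat_exp_entry
        suminf_mult[OF summable_mat_power_entry])
  finally show ?thesis
    unfolding mat_exp_entry
    using termdiffs_strong_converges_everywhere[OF summable_mat_power_entry[of A i j], of t] by simp
qed

lemma has_vector_derivative_vec:
  fixes f :: "real \<Rightarrow> real^'n"
  assumes "\<And>i. ((\<lambda>t. f t $ i) has_real_derivative d $ i) (at t)"
  shows "(f has_vector_derivative d) (at t)"
proof -
  have "((\<lambda>t. \<Sum>i\<in>UNIV. f t $ i *\<^sub>R axis i 1) has_vector_derivative (\<Sum>i\<in>UNIV. d $ i *\<^sub>R (axis i 1 :: real^'n))) (at t)"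
    using assms by (intro has_vector_derivative_sum) (auto intro!: derivative_eq_intros)
  moreover have "(\<Sum>i\<in>UNIV. x $ i *\<^sub>R axis i 1) = x" for x :: "real^'n"
    by (simp add: vec_eq_iff axis_def if_distrib cong: if_cong)
  ultimately show ?thesis by simp
qed

lemma trajectory_deriv: "(trajectory A r0 has_vector_derivative A *v trajectory A r0 t) (at t)"
proof (rule has_vector_derivative_vec)
  fix i
  have "((\<lambda>t. \<Sum>j\<in>UNIV. mat_exp (t *\<^sub>R A) $ i $ j * r0 $ j) has_real_derivative
          (\<Sum>j\<in>UNIV. (A ** mat_exp (t *\<^sub>R A)) $ i $ j * r0 $ j)) (at t)"
    by (intro DERIV_sum DERIV_cmult_right mat_exp_entry_deriv)
  then show "((\<lambda>t. trajectory A r0 t $ i) has_real_derivative (A *v trajectory A r0 t) $ i) (at t)"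
    unfolding trajectory_def matrix_vector_mul_assoc by (simp add: matrix_vector_mult_def)
qed

lemma trajectory_0 [simp]: "trajectory A r0 0 = r0"
proof -
  have "mat_exp 0 = (mat 1 :: real^3^3)"
    unfolding vec_eq_iff
  proof (intro allI)
    fix i j :: 3
    have "mat_exp (0 *\<^sub>R 0) $ i $ j = (\<Sum>k. mat_power (0 :: real^3^3) k $ i $ j / fact k * 0 ^ k)"
      by (rule mat_exp_entry)
    also have "\<dots> = mat 1 $ i $ j"
      by (subst powser_zero) simp
    finally show "mat_exp 0 $ i $ j = (mat 1 :: real^3^3) $ i $ j" by simp
  qed
  then show ?thesis by (simp add: trajectory_def)
qed

lemma linear_trajectory: "linear (\<lambda>r0. trajectory A r0 t)"
  unfolding trajectory_def by (rule matrix_vector_mul_linear)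

lemma curve_deriv_eq:
  assumes "\<And>s. s \<ge> 0 \<Longrightarrow> r s = g s" "(g has_vector_derivative d) (at t)" "t \<ge> 0"
  shows "curve_deriv r t = d"
  unfolding curve_deriv_def
proof (rule vector_derivative_within)
  have "t islimpt {t..t+1}" using islimpt_Icc[of t "t+1" t] by simp
  then have "t islimpt {0..}" by (rule islimpt_subset) (use assms(3) in auto)
  then show "at t within {0..} \<noteq> bot" by (simp add: trivial_limit_within)
  show "(r has_vector_derivative d) (at t within {0..})"
    by (rule has_vector_derivative_transform[OF _ _ has_vector_derivative_at_within[OF assms(2)]])
      (use assms in auto)
qed

lemma matrix_trajectory_deriv:
  "((\<lambda>t. B *v trajectory A r0 t) has_vector_derivative B *v (A *v trajectory A r0 t)) (at t)"
  by (rule bounded_linear.has_vector_derivative[OF _ trajectory_deriv]) simp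

lemma curve_deriv_trajectory:
  assumes "t \<ge> 0"
  shows "curve_deriv (trajectory A r0) t = A *v trajectory A r0 t"
    and "curve_deriv (curve_deriv (trajectory A r0)) t = A *v (A *v trajectory A r0 t)"
    and "curve_deriv (curve_deriv (curve_deriv (trajectory A r0))) t
           = A *v (A *v (A *v trajectory A r0 t))"
proof -
  have 1: "curve_deriv (trajectory A r0) t = A *v trajectory A r0 t" if "t \<ge> 0" for t
    by (rule curve_deriv_eq[OF refl trajectory_deriv that])
  have 2: "curve_deriv (curve_deriv (trajectory A r0)) t = A *v (A *v trajectory A r0 t)"
    if "t \<ge> 0" for t
    by (rule curve_deriv_eq[OF 1 matrix_trajectory_deriv that])
  have "((\<lambda>t. A *v (A *v trajectory A r0 t)) has_vector_derivative
            A *v (A *v (A *v trajectory A r0 t))) (at t)"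
    using matrix_trajectory_deriv[of "A ** A" A r0 t] by (simp add: matrix_vector_mul_assoc matrix_mul_assoc)
  from curve_deriv_eq[OF 2 this assms] 1[OF assms] 2[OF assms]
  show "curve_deriv (trajectory A r0) t = A *v trajectory A r0 t"
    "curve_deriv (curve_deriv (trajectory A r0)) t = A *v (A *v trajectory A r0 t)"
    "curve_deriv (curve_deriv (curve_deriv (trajectory A r0))) t
       = A *v (A *v (A *v trajectory A r0 t))"
    by auto
qed

definition velocity :: "real^3^3 \<Rightarrow> real^3 \<Rightarrow> real \<Rightarrow> real^3" where
  "velocity A r0 t = A *v trajectory A r0 t"

lemma velocity_deriv: "(velocity A r0 has_vector_derivative A *v velocity A r0 t) (at t)"
  unfolding velocity_def using matrix_trajectory_deriv .

lemma matrix_velocity_deriv: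
  "((\<lambda>t. B *v velocity A r0 t) has_vector_derivative B *v (A *v velocity A r0 t)) (at t)"
  by (rule bounded_linear.has_vector_derivative[OF _ velocity_deriv]) simp

lemma curvature_trajectory:
  "t \<ge> 0 \<Longrightarrow> curvature (trajectory A r0) t =
     norm (velocity A r0 t \<times> (A *v velocity A r0 t)) / norm (velocity A r0 t) ^ 3"
  by (simp add: curvature_def Let_def curve_deriv_trajectory velocity_def)

lemma torsion_trajectory:
  "t \<ge> 0 \<Longrightarrow> torsion (trajectory A r0) t =
     ((velocity A r0 t \<times> (A *v velocity A r0 t)) \<bullet> (A *v (A *v velocity A r0 t)))
       / (norm (velocity A r0 t \<times> (A *v velocity A r0 t)))\<^sup>2"
  by (simp add: torsion_def Let_def curve_deriv_trajectory velocity_def)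

section \<open>Linear scalar equations with constant coefficients\<close>

lemma linear_ode_solution:
  fixes f :: "real \<Rightarrow> complex"
  assumes "\<And>t. (f has_vector_derivative l * f t) (at t)"
  shows "f t = exp (of_real t * l) * f 0"
proof -
  let ?g = "\<lambda>t. exp (t *\<^sub>R (- l)) * f t"
  have e: "((\<lambda>t. exp (t *\<^sub>R (- l))) has_vector_derivative exp (t *\<^sub>R (- l)) * (- l)) (at t)" for t
    by (rule exp_scaleR_has_vector_derivative_right)
  have "(?g has_vector_derivative 0) (at t)" for t
    using has_vector_derivative_mult[OF e assms, of t] by (simp add: algebra_simps)
  then have "?g t = ?g 0"
    using has_vector_derivative_zero_constant[of UNIV ?g] by (metis UNIV_I convex_UNIV has_vector_derivative_at_within)
  then show ?thesis
    by (simp add: exp_minus scaleR_conv_of_real field_simps)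
qed

lemma norm_linear_ode_solution:
  fixes f :: "real \<Rightarrow> complex"
  assumes "\<And>t. (f has_vector_derivative l * f t) (at t)"
  shows "cmod (f t) = exp (Re l * t) * cmod (f 0)"
  by (subst linear_ode_solution[OF assms]) (simp add: norm_mult mult.commute)

lemma forced_decay_tendsto_0:
  fixes x f :: "real \<Rightarrow> complex"
  assumes x: "\<And>t. (x has_vector_derivative l * x t + f t) (at t)"
    and l: "Re l < 0" and f: "(f \<longlongrightarrow> 0) at_top"
  shows "(x \<longlongrightarrow> 0) at_top"
proof -
  define a where "a = - Re l"
  have a: "a > 0" using l by (simp add: a_def)
  define h where "h t = x t \<bullet> x t" for t
  define h' where "h' t = 2 * (x t \<bullet> (l * x t + f t))" for t
  have dh: "(h has_real_derivative h' t) (at t)" for t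
    using bounded_bilinear.has_vector_derivative[OF bounded_bilinear_inner x x, of t]
    unfolding h_def h'_def has_real_derivative_iff_has_vector_derivative
    by (simp add: inner_commute)
  have h'_le: "h' t \<le> - a * h t + (cmod (f t))\<^sup>2 / a" for t
  proof -
    have "h' t = - 2 * a * h t + 2 * (x t \<bullet> f t)"
      by (simp add: h'_def h_def a_def inner_complex_def algebra_simps)
    moreover have "2 * (x t \<bullet> f t) \<le> a * h t + (cmod (f t))\<^sup>2 / a"
    proof -
      have "0 \<le> (a *\<^sub>R x t - f t) \<bullet> (a *\<^sub>R x t - f t)" by simp
      also have "\<dots> = a\<^sup>2 * h t - 2 * a * (x t \<bullet> f t) + (cmod (f t))\<^sup>2"
        unfolding h_def power2_norm_eq_inner
        by (simp add: inner_diff_left inner_diff_right inner_commute power2_eq_square algebra_simps)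
      finally have "a * (2 * (x t \<bullet> f t)) \<le> a * (a * h t + (cmod (f t))\<^sup>2 / a)"
        using a by (simp add: power2_eq_square algebra_simps)
      then show ?thesis using a by simp
    qed
    ultimately show ?thesis by simp
  qed
  have "(h \<longlongrightarrow> 0) at_top"
  proof (rule tendstoI)
    fix e :: real assume "e > 0"
    define \<epsilon> where "\<epsilon> = e / 2"
    have \<epsilon>: "\<epsilon> > 0" using \<open>e > 0\<close> by (simp add: \<epsilon>_def)
    have "((\<lambda>t. (cmod (f t))\<^sup>2 / a) \<longlongrightarrow> 0\<^sup>2 / a) at_top"
      using a by (intro tendsto_intros tendsto_norm_zero f) auto
    then have "\<forall>\<^sub>F t in at_top. (cmod (f t))\<^sup>2 / a < a * \<epsilon>"
      using a \<epsilon> by (intro order_tendstoD(2)) auto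
    then obtain s where s: "\<And>t. t \<ge> s \<Longrightarrow> (cmod (f t))\<^sup>2 / a < a * \<epsilon>"
      by (auto simp: eventually_at_top_linorder)
    let ?G = "\<lambda>t. (h t - \<epsilon>) * exp (a * t)"
    have mono: "?G t \<le> ?G s" if "t \<ge> s" for t
    proof (rule DERIV_nonpos_imp_nonincreasing[OF that])
      fix u assume u: "s \<le> u" "u \<le> t"
      have "(?G has_real_derivative (h' u + a * (h u - \<epsilon>)) * exp (a * u)) (at u)"
        by (auto intro!: derivative_eq_intros dh simp: algebra_simps)
      moreover have "(h' u + a * (h u - \<epsilon>)) * exp (a * u) \<le> 0"
        using h'_le[of u] s[OF u(1)] by (intro mult_nonpos_nonneg) (auto simp: algebra_simps)
      ultimately show "\<exists>y. (?G has_real_derivative y) (at u) \<and> y \<le> 0" by blast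
    qed
    have "((\<lambda>t. exp (- (a * t))) \<longlongrightarrow> 0) at_top"
      using a by real_asymp
    then have "((\<lambda>t. \<bar>?G s\<bar> * exp (- (a * t))) \<longlongrightarrow> 0) at_top"
      by (rule tendsto_mult_right_zero)
    then have "\<forall>\<^sub>F t in at_top. \<bar>?G s\<bar> * exp (- (a * t)) < \<epsilon>"
      using \<epsilon> by (intro order_tendstoD(2)) auto
    with eventually_ge_at_top[of s] show "\<forall>\<^sub>F t in at_top. dist (h t) 0 < e"
    proof eventually_elim
      case (elim t)
      have "(h t - \<epsilon>) = ?G t * exp (- (a * t))" by (simp add: mult.assoc flip: exp_add)
      also have "\<dots> \<le> \<bar>?G s\<bar> * exp (- (a * t))"
        using mono[OF elim(1)] by (intro mult_right_mono) auto
      finally have "h t < 2 * \<epsilon>" using elim(2) by simp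
      moreover have "h t \<ge> 0" by (simp add: h_def)
      ultimately show ?case by (simp add: \<epsilon>_def)
    qed
  qed
  then have "((\<lambda>t. (cmod (x t))\<^sup>2) \<longlongrightarrow> 0) at_top"
    by (simp add: h_def[abs_def] power2_norm_eq_inner)
  then have "((\<lambda>t. cmod (x t)) \<longlongrightarrow> 0) at_top"
    using tendsto_real_sqrt by fastforce
  then show ?thesis by (simp add: tendsto_norm_zero_iff)
qed

lemma second_order_tendsto_0:
  fixes x0 x1 :: "real \<Rightarrow> complex"
  assumes d0: "\<And>t. (x0 has_vector_derivative x1 t) (at t)"
    and d1: "\<And>t. (x1 has_vector_derivative (k + l) * x1 t - k * l * x0 t + f t) (at t)"
    and "Re k < 0" "Re l < 0" "(f \<longlongrightarrow> 0) at_top"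
  shows "(x0 \<longlongrightarrow> 0) at_top"
proof -
  have *: "((\<lambda>t. x1 t - l * x0 t) \<longlongrightarrow> 0) at_top"
    by (rule forced_decay_tendsto_0[OF _ assms(3,5)])
      (auto intro!: derivative_eq_intros d0 d1 simp: algebra_simps)
  show ?thesis
    by (rule forced_decay_tendsto_0[OF _ assms(4) *]) (use d0 in simp)
qed

lemma third_order_tendsto_0:
  fixes x0 x1 x2 :: "real \<Rightarrow> complex"
  assumes d0: "\<And>t. (x0 has_vector_derivative x1 t) (at t)"
    and d1: "\<And>t. (x1 has_vector_derivative x2 t) (at t)"
    and d2: "\<And>t. (x2 has_vector_derivative
               (j + k + l) * x2 t - (j * k + k * l + l * j) * x1 t + j * k * l * x0 t) (at t)"
    and "Re j < 0" "Re k < 0" "Re l < 0"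
  shows "(x0 \<longlongrightarrow> 0) at_top"
proof -
  have *: "((\<lambda>t. x2 t - (k + l) * x1 t + k * l * x0 t) \<longlongrightarrow> 0) at_top"
    by (rule forced_decay_tendsto_0[OF _ assms(4) tendsto_const])
      (auto intro!: derivative_eq_intros d0 d1 d2 simp: algebra_simps)
  show ?thesis
    by (rule second_order_tendsto_0[OF d0 _ assms(5,6) *]) (use d1 in simp)
qed

lemma third_order_bounded:
  fixes x0 x1 x2 :: "real \<Rightarrow> complex"
  assumes d0: "\<And>t. (x0 has_vector_derivative x1 t) (at t)"
    and d1: "\<And>t. (x1 has_vector_derivative x2 t) (at t)"
    and d2: "\<And>t. (x2 has_vector_derivative
               (j + k + l) * x2 t - (j * k + k * l + l * j) * x1 t + j * k * l * x0 t) (at t)"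
    and re: "Re j \<le> 0" "Re k \<le> 0" "Re l \<le> 0" and distinct: "j \<noteq> k" "k \<noteq> l" "l \<noteq> j"
  shows "bounded (x0 ` {0..})"
proof -
  define y where "y k l t = x2 t - (k + l) * x1 t + k * l * x0 t" for k l t
  have y: "cmod (y k l t) \<le> cmod (y k l 0)"
    if "\<And>t. (y k l has_vector_derivative j * y k l t) (at t)" "Re j \<le> 0" "t \<ge> 0" for j k l t
    using norm_linear_ode_solution[of "y k l" j, OF that(1), of t] that(2,3)
    by (simp add: mult_nonpos_nonneg mult_left_le_one_le)
  have y1: "cmod (y k l t) \<le> cmod (y k l 0)" if "t \<ge> 0" for t
    by (rule y[OF _ re(1) that])
      (unfold y_def, auto intro!: derivative_eq_intros d0 d1 d2 simp: algebra_simps)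
  have y2: "cmod (y l j t) \<le> cmod (y l j 0)" if "t \<ge> 0" for t
    by (rule y[OF _ re(2) that])
      (unfold y_def, auto intro!: derivative_eq_intros d0 d1 d2 simp: algebra_simps)
  have y3: "cmod (y j k t) \<le> cmod (y j k 0)" if "t \<ge> 0" for t
    by (rule y[OF _ re(3) that])
      (unfold y_def, auto intro!: derivative_eq_intros d0 d1 d2 simp: algebra_simps)
  let ?V = "(j - k) * (k - l) * (l - j)"
  let ?B = "cmod (k - l) * cmod (y k l 0) + cmod (l - j) * cmod (y l j 0) + cmod (j - k) * cmod (y j k 0)"
  have "cmod (x0 t) \<le> ?B / cmod ?V" if "t \<ge> 0" for t
  proof -
    (* Lagrange interpolation of the constant polynomial 1 at the three characteristic roots *)
    have "?V * x0 t = - ((k - l) * y k l t + (l - j) * y l j t + (j - k) * y j k t)"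
      by (simp add: y_def algebra_simps)
    then have "cmod ?V * cmod (x0 t) = cmod ((k - l) * y k l t + (l - j) * y l j t + (j - k) * y j k t)"
      by (metis norm_minus_cancel norm_mult)
    also have "\<dots> \<le> cmod (k - l) * cmod (y k l t) + cmod (l - j) * cmod (y l j t) + cmod (j - k) * cmod (y j k t)"
      by (metis add_mono norm_mult norm_triangle_ineq norm_triangle_le order_refl)
    also have "\<dots> \<le> ?B"
      by (intro add_mono mult_left_mono y1 y2 y3 that) auto
    finally show ?thesis
      using distinct by (subst pos_le_divide_eq) (simp_all add: mult.commute)
  qed
  then show ?thesis by (auto simp: bounded_iff)
qed

section \<open>The spectrum of a real 3 by 3 matrix\<close>

definition minor_sum :: "real^3^3 \<Rightarrow> real" where
  "minor_sum A = A$1$1 * A$2$2 - A$1$2 * A$2$1 + (A$1$1 * A$3$3 - A$1$3 * A$3$1)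
     + (A$2$2 * A$3$3 - A$2$3 * A$3$2)"

lemma cayley_hamilton_3:
  "A *v (A *v (A *v x)) = trace A *\<^sub>R (A *v (A *v x)) - minor_sum A *\<^sub>R (A *v x) + det A *\<^sub>R x"
  by (simp add: vec_eq_iff forall_3 matrix_vector_mult_def sum_3 det_3 trace_def minor_sum_def)
    (simp add: algebra_simps)

lemma trace_cross_identity:
  fixes A :: "real^3^3"
  shows "(A *v u) \<bullet> (x \<times> y) + u \<bullet> ((A *v x) \<times> y) + u \<bullet> (x \<times> (A *v y)) = trace A * (u \<bullet> (x \<times> y))"
  by (simp add: cross3_def inner_vec_def matrix_vector_mult_def sum_3 trace_def vector_def algebra_simps)

lemma trace_transpose: "trace (transpose A) = trace A"
  by (simp add: trace_def transpose_def)

lemma minor_sum_transpose: "minor_sum (transpose A) = minor_sum A"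
  by (simp add: minor_sum_def transpose_def)

lemma cramer_cross:
  "((x \<times> y) \<bullet> z) *\<^sub>R p = (p \<bullet> (y \<times> z)) *\<^sub>R x + (p \<bullet> (z \<times> x)) *\<^sub>R y + (p \<bullet> (x \<times> y)) *\<^sub>R z"
  by (simp add: cross3_def inner_vec_def sum_3 vec_eq_iff forall_3 vector_def algebra_simps)

definition spectrum3 :: "real^3^3 \<Rightarrow> complex \<Rightarrow> complex \<Rightarrow> complex \<Rightarrow> bool" where
  "spectrum3 A j k l \<longleftrightarrow> of_real (trace A) = j + k + l \<and>
     of_real (minor_sum A) = j * k + k * l + l * j \<and> of_real (det A) = j * k * l"

lemma spectrum3_transpose: "spectrum3 (transpose A) j k l = spectrum3 A j k l"
  by (simp add: spectrum3_def trace_transpose minor_sum_transpose)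

lemma real_cubic_root:
  fixes a b c :: real
  obtains x where "x ^ 3 - a * x\<^sup>2 + b * x - c = 0"
proof -
  let ?f = "\<lambda>x. x ^ 3 - a * x\<^sup>2 + b * x - c"
  have "filterlim ?f at_top at_top" "filterlim ?f at_bot at_bot" by real_asymp+
  then have "\<forall>\<^sub>F x in at_top. ?f x \<ge> 0" "\<forall>\<^sub>F x in at_bot. ?f x \<le> 0"
    unfolding filterlim_at_top filterlim_at_bot by blast+
  then obtain u w where u: "\<And>x. x \<ge> u \<Longrightarrow> ?f x \<ge> 0" and w: "\<And>x. x \<le> w \<Longrightarrow> ?f x \<le> 0"
    unfolding eventually_at_top_linorder eventually_at_bot_linorder by blast
  have "\<exists>x\<ge>min u w. x \<le> max u w \<and> ?f x = 0"
    by (rule IVT') (use u[of "max u w"] w[of "min u w"] in \<open>auto intro!: continuous_intros\<close>)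
  then show ?thesis using that by blast
qed

lemma spectrum3_cases:
  obtains a b c :: real where "spectrum3 A (of_real a) (of_real b) (of_real c)" "a \<ge> b" "b \<ge> c"
  | \<mu> \<alpha> \<beta> :: real where "spectrum3 A (of_real \<mu>) (Complex \<alpha> \<beta>) (Complex \<alpha> (- \<beta>))" "\<beta> \<noteq> 0"
proof -
  obtain \<mu> where \<mu>: "\<mu> ^ 3 - trace A * \<mu>\<^sup>2 + minor_sum A * \<mu> - det A = 0"
    by (rule real_cubic_root)
  define p where "p = \<mu> - trace A"
  define q where "q = minor_sum A + \<mu> * p"
  have T: "trace A = \<mu> - p" and M: "minor_sum A = q - \<mu> * p" and D: "det A = \<mu> * q"
    using \<mu> by (auto simp: p_def q_def power2_eq_square power3_eq_cube algebra_simps)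
  show ?thesis
  proof (cases "p\<^sup>2 - 4 * q \<ge> 0")
    case True
    define s where "s = sqrt (p\<^sup>2 - 4 * q)"
    define b where "b = (- p + s) / 2"
    define c where "c = (- p - s) / 2"
    have s: "s\<^sup>2 = p\<^sup>2 - 4 * q" "s \<ge> 0" using True by (auto simp: s_def)
    have bc: "b + c = - p" "b * c = q"
      using s by (auto simp: b_def c_def field_simps power2_eq_square)
    have "b \<ge> c" using s by (simp add: b_def c_def)
    have sp: "spectrum3 A (of_real x) (of_real y) (of_real z)"
      if "x + y + z = \<mu> + b + c" "x * y + y * z + z * x = \<mu> * b + b * c + c * \<mu>" "x * y * z = \<mu> * b * c"
      for x y z
    proof -
      have pq: "p = - (b + c)" "q = b * c" using bc by auto
      have "trace A = x + y + z" "minor_sum A = x * y + y * z + z * x" "det A = x * y * z"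
        unfolding that T M D pq by (simp_all add: algebra_simps)
      then show ?thesis by (simp add: spectrum3_def)
    qed
    consider "\<mu> \<ge> b" | "b \<ge> \<mu>" "\<mu> \<ge> c" | "c \<ge> \<mu>" by linarith
    then show ?thesis
    proof cases
      case 1
      show ?thesis by (rule that(1)[of \<mu> b c]) (use 1 \<open>b \<ge> c\<close> in \<open>auto intro!: sp\<close>)
    next
      case 2
      show ?thesis by (rule that(1)[of b \<mu> c]) (use 2 in \<open>auto intro!: sp simp: algebra_simps\<close>)
    next
      case 3
      show ?thesis by (rule that(1)[of b c \<mu>]) (use 3 \<open>b \<ge> c\<close> in \<open>auto intro!: sp simp: algebra_simps\<close>)
    qed
  next
    case False
    define \<alpha> where "\<alpha> = - p / 2"
    define \<beta> where "\<beta> = sqrt (q - p\<^sup>2 / 4)"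
    have "\<beta>\<^sup>2 = q - p\<^sup>2 / 4" using False by (simp add: \<beta>_def)
    moreover have "\<beta> \<noteq> 0" using False by (simp add: \<beta>_def)
    moreover have "p = - 2 * \<alpha>" by (simp add: \<alpha>_def)
    ultimately have "q = \<alpha>\<^sup>2 + \<beta>\<^sup>2" "p = - 2 * \<alpha>" by (auto simp: power2_eq_square)
    then have "spectrum3 A (of_real \<mu>) (Complex \<alpha> \<beta>) (Complex \<alpha> (- \<beta>))"
      unfolding spectrum3_def T M D
      by (simp add: complex_eq_iff power2_eq_square algebra_simps)
    then show ?thesis using that(2) \<open>\<beta> \<noteq> 0\<close> by blast
  qed
qed

lemma eigenvector_real_parts:
  assumes "spectrum3 A j k l"
  obtains p q where "p \<noteq> 0 \<or> q \<noteq> 0" "A *v p = Re j *\<^sub>R p - Im j *\<^sub>R q" "A *v q = Im j *\<^sub>R p + Re j *\<^sub>R q"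
proof -
  define M :: "complex^3^3" where "M = (\<chi> i m. of_real (A $ i $ m) - (if i = m then j else 0))"
  have "j ^ 3 - of_real (trace A) * j\<^sup>2 + of_real (minor_sum A) * j - of_real (det A) = 0"
    using assms unfolding spectrum3_def by (simp add: power2_eq_square power3_eq_cube algebra_simps)
  moreover have "det M = - (j ^ 3 - of_real (trace A) * j\<^sup>2 + of_real (minor_sum A) * j - of_real (det A))"
    by (simp add: M_def det_3 trace_def sum_3 minor_sum_def power2_eq_square power3_eq_cube algebra_simps)
  ultimately have "det M = 0" by simp
  then have "\<not> (\<exists>B. B ** M = mat 1)"
    by (metis invertible_det_nz invertible_left_inverse)
  then obtain u where u: "M *v u = 0" "u \<noteq> 0"
    unfolding matrix_left_invertible_ker by blast
  define p where "p = (\<chi> i. Re (u $ i))"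
  define q where "q = (\<chi> i. Im (u $ i))"
  show ?thesis
  proof (rule that[of p q])
    show "p \<noteq> 0 \<or> q \<noteq> 0"
      using u(2) by (auto simp: p_def q_def vec_eq_iff complex_eq_iff)
    have "(\<Sum>m\<in>UNIV. of_real (A $ i $ m) * u $ m) = j * u $ i" for i
    proof -
      have "(M *v u) $ i = (\<Sum>m\<in>UNIV. of_real (A $ i $ m) * u $ m - (if i = m then j * u $ m else 0))"
        unfolding M_def matrix_vector_mult_def by (auto intro!: sum.cong simp: left_diff_distrib)
      then show ?thesis using u(1) by (simp add: sum_subtractf)
    qed
    then have "Re (\<Sum>m\<in>UNIV. of_real (A $ i $ m) * u $ m) = Re (j * u $ i)"
      "Im (\<Sum>m\<in>UNIV. of_real (A $ i $ m) * u $ m) = Im (j * u $ i)" for i by auto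
    then show "A *v p = Re j *\<^sub>R p - Im j *\<^sub>R q" "A *v q = Im j *\<^sub>R p + Re j *\<^sub>R q"
      by (auto simp: p_def q_def vec_eq_iff matrix_vector_mult_def)
  qed
qed

section \<open>Boundedness and decay of trajectories\<close>

lemma spectrum3_rotate: "spectrum3 A j k l \<Longrightarrow> spectrum3 A k l j"
  by (simp add: spectrum3_def algebra_simps)

lemma spectrum3_cayley_hamilton:
  assumes "spectrum3 A (of_real a) (of_real b) (of_real c)"
  shows "A *v (A *v (A *v x)) =
    (a + b + c) *\<^sub>R (A *v (A *v x)) - (a * b + b * c + c * a) *\<^sub>R (A *v x) + (a * b * c) *\<^sub>R x"
proof -
  have "trace A = a + b + c" "minor_sum A = a * b + b * c + c * a" "det A = a * b * c"
    using assms unfolding spectrum3_def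
    by (simp_all only: of_real_eq_iff flip: of_real_add of_real_mult)
  then show ?thesis by (simp add: cayley_hamilton_3)
qed

lemma bounded_of_convergent_curve:
  fixes f :: "real \<Rightarrow> 'a::real_normed_vector"
  assumes "continuous_on {0..} f" "(f \<longlongrightarrow> L) at_top"
  shows "bounded (f ` {0..})"
proof -
  obtain s where s: "\<And>t. t \<ge> s \<Longrightarrow> dist (f t) L < 1"
    using tendstoD[OF assms(2), of 1] by (auto simp: eventually_at_top_linorder)
  have "f ` {s..} \<subseteq> cball L 1"
    using s by (force simp: dist_commute intro: less_imp_le)
  then have "bounded (f ` {s..})"
    by (rule bounded_subset[OF bounded_cball])
  moreover have "bounded (f ` {0..s})"
    by (intro compact_imp_bounded compact_continuous_image continuous_on_subset[OF assms(1)]) auto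
  ultimately have "bounded (f ` ({0..s} \<union> {s..}))" by (simp add: image_Un)
  then show ?thesis by (rule bounded_subset) (intro image_mono, auto)
qed

lemma continuous_on_trajectory: "continuous_on S (trajectory A r0)"
  by (meson continuous_at_imp_continuous_on has_vector_derivative_continuous trajectory_deriv)

lemma zero_stable_if_bounded:
  assumes "\<And>r0. bounded (trajectory A r0 ` {0..})"
  shows "zero_stable A"
proof -
  have "\<exists>B. \<forall>t\<ge>0. norm (trajectory A (axis i 1) t) \<le> B" for i
    using assms[of "axis i 1"] by (auto simp: bounded_iff)
  then obtain B where B: "\<And>i t. t \<ge> 0 \<Longrightarrow> norm (trajectory A (axis i 1) t) \<le> B i"
    by metis
  have B0: "B i \<ge> 0" for i using B[of 0 i] norm_ge_zero order_trans by blast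
  define K where "K = 1 + (\<Sum>i\<in>UNIV. B i)"
  have K: "K > 0" using sum_nonneg[of UNIV B] B0 by (simp add: K_def add_pos_nonneg)
  have le: "norm (trajectory A r0 t) \<le> K * norm r0" if t: "t \<ge> 0" for r0 t
  proof -
    have "trajectory A r0 t = (\<Sum>i\<in>UNIV. r0 $ i *\<^sub>R trajectory A (axis i 1) t)"
    proof -
      have "r0 = (\<Sum>i\<in>UNIV. r0 $ i *\<^sub>R axis i 1)"
        by (simp add: vec_eq_iff axis_def if_distrib cong: if_cong)
      then have "trajectory A r0 t = trajectory A (\<Sum>i\<in>UNIV. r0 $ i *\<^sub>R axis i 1) t"
        by simp
      also have "\<dots> = (\<Sum>i\<in>UNIV. r0 $ i *\<^sub>R trajectory A (axis i 1) t)"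
        by (simp only: linear_sum[OF linear_trajectory] linear_scale[OF linear_trajectory])
      finally show ?thesis .
    qed
    also have "norm \<dots> \<le> (\<Sum>i\<in>UNIV. norm (r0 $ i *\<^sub>R trajectory A (axis i 1) t))"
      by (rule norm_sum)
    also have "\<dots> \<le> (\<Sum>i\<in>UNIV. norm r0 * B i)"
      by (intro sum_mono) (auto intro!: mult_mono B t component_le_norm_cart)
    also have "\<dots> \<le> K * norm r0"
      unfolding K_def by (subst sum_distrib_left[symmetric]) (simp add: algebra_simps)
    finally show ?thesis .
  qed
  show ?thesis
    unfolding zero_stable_def
  proof (intro allI impI)
    fix \<epsilon> :: real assume "\<epsilon> > 0"
    have "norm (trajectory A r0 t) < \<epsilon>" if "norm r0 < \<epsilon> / K" "t \<ge> 0" for r0 t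
      using le[OF that(2), of r0] that(1) K by (simp add: field_simps)
    then show "\<exists>\<delta>>0. \<forall>r0. norm r0 < \<delta> \<longrightarrow> (\<forall>t\<ge>0. norm (trajectory A r0 t) < \<epsilon>)"
      using \<open>\<epsilon> > 0\<close> K by (intro exI[of _ "\<epsilon> / K"]) auto
  qed
qed

lemma zero_asymptotically_stable_if_tendsto_0:
  assumes "\<And>r0. (trajectory A r0 \<longlongrightarrow> 0) at_top"
  shows "zero_asymptotically_stable A"
  unfolding zero_asymptotically_stable_def
  using assms zero_stable_if_bounded[OF bounded_of_convergent_curve[OF continuous_on_trajectory assms]]
  by (auto intro: exI[of _ 1])

lemma component_deriv:
  assumes "(x has_vector_derivative d) (at t)"
  shows "((\<lambda>t. complex_of_real (x t $ i)) has_vector_derivative complex_of_real (d $ i)) (at t)"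
proof -
  have "bounded_linear (\<lambda>v. complex_of_real (v $ i))"
    by (rule bounded_linear_compose[OF bounded_linear_of_real bounded_linear_vec_nth])
  from bounded_linear.has_vector_derivative[OF this assms] show ?thesis .
qed

lemma scaleR_deriv:
  "(f has_vector_derivative d) (at t) \<Longrightarrow> ((\<lambda>t. c *\<^sub>R f t) has_vector_derivative c *\<^sub>R d) (at t)"
  by (rule bounded_linear.has_vector_derivative[OF bounded_linear_scaleR_right])

lemma constant_if_deriv_0:
  fixes f :: "real \<Rightarrow> 'a::real_normed_vector"
  assumes "\<And>t. (f has_vector_derivative 0) (at t)"
  shows "f t = f 0"
  using has_vector_derivative_zero_constant[of UNIV f] assms
  by (metis UNIV_I convex_UNIV has_vector_derivative_at_within)

lemma component_tendsto_0:
  assumes "\<And>i. ((\<lambda>t. complex_of_real (x t $ i)) \<longlongrightarrow> 0) F"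
  shows "(x \<longlongrightarrow> 0) F"
proof (rule vec_tendstoI)
  fix i
  show "((\<lambda>t. x t $ i) \<longlongrightarrow> 0 $ i) F"
    using tendsto_Re[OF assms[of i]] by simp
qed

lemma component_third_order:
  assumes "spectrum3 A j k l"
  shows "((\<lambda>t. complex_of_real ((A *v (A *v trajectory A r0 t)) $ i)) has_vector_derivative
      (j + k + l) * complex_of_real ((A *v (A *v trajectory A r0 t)) $ i)
       - (j * k + k * l + l * j) * complex_of_real ((A *v trajectory A r0 t) $ i)
       + j * k * l * complex_of_real (trajectory A r0 t $ i)) (at t)"
proof -
  have "((\<lambda>t. A *v (A *v trajectory A r0 t)) has_vector_derivative
            A *v (A *v (A *v trajectory A r0 t))) (at t)"
    using matrix_trajectory_deriv[of "A ** A" A r0 t] by (simp add: matrix_vector_mul_assoc matrix_mul_assoc)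
  from component_deriv[OF this, of i] show ?thesis
    using assms by (simp add: cayley_hamilton_3 spectrum3_def)
qed

lemma trajectory_tendsto_0:
  assumes "spectrum3 A j k l" "Re j < 0" "Re k < 0" "Re l < 0"
  shows "(trajectory A r0 \<longlongrightarrow> 0) at_top"
  by (rule component_tendsto_0,
      rule third_order_tendsto_0[OF component_deriv[OF trajectory_deriv]
        component_deriv[OF matrix_trajectory_deriv] component_third_order[OF assms(1)]])
    (use assms in auto)

lemma bounded_trajectory_distinct:
  assumes "spectrum3 A j k l" "Re j \<le> 0" "Re k \<le> 0" "Re l \<le> 0" "j \<noteq> k" "k \<noteq> l" "l \<noteq> j"
  shows "bounded (trajectory A r0 ` {0..})"
proof -
  have bd: "bounded ((\<lambda>t. complex_of_real (trajectory A r0 t $ i)) ` {0..})" for i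
    by (rule third_order_bounded[OF component_deriv[OF trajectory_deriv]
        component_deriv[OF matrix_trajectory_deriv] component_third_order[OF assms(1)]])
      (use assms in auto)
  have "\<exists>B. \<forall>t\<ge>0. \<bar>trajectory A r0 t $ i\<bar> \<le> B" for i
    using bd[of i] by (auto simp: bounded_iff)
  then obtain B where B: "\<And>i t. t \<ge> 0 \<Longrightarrow> \<bar>trajectory A r0 t $ i\<bar> \<le> B i" by metis
  have "norm (trajectory A r0 t) \<le> (\<Sum>i\<in>UNIV. B i)" if "t \<ge> 0" for t
    using norm_le_l1_cart[of "trajectory A r0 t"] sum_mono[of UNIV, OF B[OF that]] by (rule order_trans)
  then show ?thesis by (auto simp: bounded_iff)
qed

lemma bounded_trajectory_simple_zero:
  assumes sp: "spectrum3 A 0 (of_real b) (of_real c)" and "b < 0" "c < 0"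
  shows "bounded (trajectory A r0 ` {0..})"
proof (rule bounded_of_convergent_curve[OF continuous_on_trajectory])
  let ?r = "trajectory A r0" and ?v = "velocity A r0"
  have ch: "A *v (A *v (A *v x)) = (b + c) *\<^sub>R (A *v (A *v x)) - (b * c) *\<^sub>R (A *v x)" for x
    using spectrum3_cayley_hamilton[of A 0 b c x] sp by simp
  note v' = matrix_velocity_deriv[of A A r0]
  have v0: "(?v \<longlongrightarrow> 0) at_top"
  proof (rule component_tendsto_0, rule second_order_tendsto_0[OF component_deriv[OF velocity_deriv]])
    fix i t
    show "((\<lambda>t. complex_of_real ((A *v ?v t) $ i)) has_vector_derivative
        (complex_of_real b + complex_of_real c) * complex_of_real ((A *v ?v t) $ i)
          - complex_of_real b * complex_of_real c * complex_of_real (?v t $ i) + 0) (at t)"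
      using component_deriv[OF v', of i] by (simp add: velocity_def ch)
  qed (use assms in auto)
  define n where "n t = A *v ?v t - (b + c) *\<^sub>R ?v t + (b * c) *\<^sub>R ?r t" for t
  have "(n has_vector_derivative A *v (A *v ?v t) - (b + c) *\<^sub>R (A *v ?v t) + (b * c) *\<^sub>R (A *v ?r t)) (at t)" for t
    unfolding n_def
    by (intro has_vector_derivative_add has_vector_derivative_diff scaleR_deriv v' velocity_deriv trajectory_deriv)
  then have n: "n t = n 0" for t
    by (intro constant_if_deriv_0) (simp add: velocity_def ch)
  have r: "?r = (\<lambda>t. (1 / (b * c)) *\<^sub>R (n 0 - A *v ?v t + (b + c) *\<^sub>R ?v t))"
  proof
    fix t
    have eq: "(b * c) *\<^sub>R ?r t = n 0 - A *v ?v t + (b + c) *\<^sub>R ?v t"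
      unfolding n[of t, symmetric] by (simp add: n_def)
    have "b * c \<noteq> 0" using assms by simp
    then show "?r t = (1 / (b * c)) *\<^sub>R (n 0 - A *v ?v t + (b + c) *\<^sub>R ?v t)"
      unfolding eq[symmetric] by simp
  qed
  have "((\<lambda>t. A *v ?v t) \<longlongrightarrow> A *v 0) at_top"
    by (rule bounded_linear.tendsto[OF _ v0]) simp
  then show "(?r \<longlongrightarrow> (1 / (b * c)) *\<^sub>R (n 0 - A *v 0 + (b + c) *\<^sub>R 0)) at_top"
    by (subst r) (intro tendsto_intros v0)
qed

section \<open>Curvature\<close>

lemma norm_cross3_le: "norm (x \<times> y) \<le> norm x * norm y"
proof (rule power2_le_imp_le)
  show "(norm (x \<times> y))\<^sup>2 \<le> (norm x * norm y)\<^sup>2"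
    by (simp add: norm_cross power_mult_distrib)
qed simp

lemma curvature_nonneg: "curvature r t \<ge> 0"
  by (simp add: curvature_def Let_def)

lemma curvature_le:
  assumes "t \<ge> 0"
  shows "curvature (trajectory A r0) t \<le> onorm ((*v) A) / norm (velocity A r0 t)"
proof -
  let ?v = "velocity A r0 t"
  have "norm (A *v ?v) \<le> onorm ((*v) A) * norm ?v" by (rule onorm) simp
  then have "norm (?v \<times> (A *v ?v)) \<le> norm ?v * (onorm ((*v) A) * norm ?v)"
    using norm_cross3_le[of ?v "A *v ?v"] mult_left_mono[of _ _ "norm ?v"] by fastforce
  then have "norm (?v \<times> (A *v ?v)) / norm ?v ^ 3 \<le> norm ?v * (onorm ((*v) A) * norm ?v) / norm ?v ^ 3"
    by (rule divide_right_mono) simp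
  also have "\<dots> = onorm ((*v) A) / norm ?v"
    by (simp add: power3_eq_cube)
  finally show ?thesis by (simp add: curvature_trajectory assms)
qed

lemma curvature_tendsto_0_if_velocity_at_top:
  assumes "filterlim (\<lambda>t. norm (velocity A r0 t)) at_top at_top"
  shows "(curvature (trajectory A r0) \<longlongrightarrow> 0) at_top"
proof (rule tendsto_sandwich[OF _ _ tendsto_const])
  show "\<forall>\<^sub>F t in at_top. curvature (trajectory A r0) t \<le> onorm ((*v) A) / norm (velocity A r0 t)"
    using eventually_ge_at_top[of 0] by eventually_elim (rule curvature_le)
  show "((\<lambda>t. onorm ((*v) A) / norm (velocity A r0 t)) \<longlongrightarrow> 0) at_top"
    by (rule tendsto_divide_0[OF tendsto_const filterlim_at_top_imp_at_infinity[OF assms]])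
qed (simp add: curvature_nonneg)

lemma velocity_tendsto_0_if_curvature_at_top:
  assumes "filterlim (curvature (trajectory A r0)) at_top at_top"
  shows "(velocity A r0 \<longlongrightarrow> 0) at_top"
proof (rule tendstoI)
  fix e :: real assume "e > 0"
  let ?K = "onorm ((*v) A)"
  have "\<forall>\<^sub>F t in at_top. curvature (trajectory A r0) t > ?K / e"
    using assms by (simp add: filterlim_at_top_dense)
  with eventually_ge_at_top[of 0] show "\<forall>\<^sub>F t in at_top. dist (velocity A r0 t) 0 < e"
  proof eventually_elim
    case (elim t)
    have lt: "?K / e < ?K / norm (velocity A r0 t)"
      using curvature_le[OF elim(1), of A r0] elim(2) by simp
    have "?K \<ge> 0" by (intro onorm_pos_le) simp
    show ?case
    proof (rule ccontr)
      assume "\<not> dist (velocity A r0 t) 0 < e"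
      then have "e \<le> norm (velocity A r0 t)" by simp
      then have "?K / norm (velocity A r0 t) \<le> ?K / e"
        using \<open>e > 0\<close> \<open>?K \<ge> 0\<close> by (intro divide_left_mono mult_pos_pos) linarith+
      with lt show False by simp
    qed
  qed
qed

lemma curvature_tendsto_0_double_zero:
  assumes sp: "spectrum3 A 0 0 (of_real c)" and c: "c \<le> 0"
  shows "(curvature (trajectory A r0) \<longlongrightarrow> 0) at_top"
proof -
  let ?v = "velocity A r0"
  have ch: "A *v (A *v (A *v x)) = c *\<^sub>R (A *v (A *v x))" for x
    using spectrum3_cayley_hamilton[of A 0 0 c x] sp by simp
  note v' = matrix_velocity_deriv[of A A r0]
  define n where "n t = A *v ?v t - c *\<^sub>R ?v t" for t
  have "(n has_vector_derivative A *v (A *v ?v t) - c *\<^sub>R (A *v ?v t)) (at t)" for t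
    unfolding n_def by (intro has_vector_derivative_diff scaleR_deriv v' velocity_deriv)
  then have n: "n t = n 0" for t
    by (intro constant_if_deriv_0) (simp add: velocity_def ch)
  then have Av: "A *v ?v t = n 0 + c *\<^sub>R ?v t" for t
    by (metis n_def diff_add_cancel)
  have ev: "\<forall>\<^sub>F t in at_top. norm (?v t \<times> (A *v ?v t)) / norm (?v t) ^ 3 = curvature (trajectory A r0) t"
    using eventually_ge_at_top[of 0] by eventually_elim (simp add: curvature_trajectory)
  consider "n 0 = 0" | "n 0 \<noteq> 0" "c < 0" | "n 0 \<noteq> 0" "c = 0" using c by linarith
  then show ?thesis
  proof cases
    case 1
    then have "?v t \<times> (A *v ?v t) = 0" for t
      by (simp add: Av cross_mult_right)
    then have "curvature (trajectory A r0) t = 0" if "t \<ge> 0" for t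
      using that by (simp add: curvature_trajectory)
    then have "\<forall>\<^sub>F t in at_top. curvature (trajectory A r0) t = 0"
      unfolding eventually_at_top_linorder by blast
    then show ?thesis by (rule tendsto_eventually)
  next
    case 2
    have Av0: "((\<lambda>t. A *v ?v t) \<longlongrightarrow> 0) at_top"
    proof (rule component_tendsto_0, rule forced_decay_tendsto_0[OF _ _ tendsto_const])
      fix i t
      show "((\<lambda>t. complex_of_real ((A *v ?v t) $ i)) has_vector_derivative
          complex_of_real c * complex_of_real ((A *v ?v t) $ i) + 0) (at t)"
        using component_deriv[OF v', of i] by (simp add: velocity_def ch)
    qed (use 2 in auto)
    have v: "?v = (\<lambda>t. (1 / c) *\<^sub>R (A *v ?v t - n 0))"
      using 2 by (auto simp: Av)
    let ?L = "(1 / c) *\<^sub>R (0 - n 0)"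
    have vL: "(?v \<longlongrightarrow> ?L) at_top"
      by (subst v) (intro tendsto_intros Av0)
    have "((\<lambda>t. ?v t \<times> (A *v ?v t)) \<longlongrightarrow> ?L \<times> 0) at_top"
      using bounded_bilinear.tendsto[OF bilinear_cross[unfolded bilinear_conv_bounded_bilinear] vL Av0] .
    then have "((\<lambda>t. norm (?v t \<times> (A *v ?v t)) / norm (?v t) ^ 3) \<longlongrightarrow> norm (?L \<times> 0) / norm ?L ^ 3) at_top"
      using 2 by (intro tendsto_intros vL) auto
    then show ?thesis
      using tendsto_cong[OF ev] by simp
  next
    case 3
    have "((\<lambda>t. t *\<^sub>R n 0) has_vector_derivative n 0) (at t)" for t
      by (auto intro!: derivative_eq_intros)
    from has_vector_derivative_diff[OF velocity_deriv this, of A r0]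
    have "((\<lambda>t. ?v t - t *\<^sub>R n 0) has_vector_derivative 0) (at t)" for t
      by (simp add: Av 3)
    then have vc: "?v t - t *\<^sub>R n 0 = ?v 0 - 0 *\<^sub>R n 0" for t
      by (rule constant_if_deriv_0)
    have v: "?v t = ?v 0 + t *\<^sub>R n 0" for t
      using vc[of t] by (simp add: diff_eq_eq)
    have "filterlim (\<lambda>t. norm (?v t)) at_top at_top"
    proof (rule filterlim_at_top_mono)
      show "filterlim (\<lambda>t. t * norm (n 0) - norm (?v 0)) at_top at_top"
        using \<open>n 0 \<noteq> 0\<close> by real_asymp
      show "\<forall>\<^sub>F t in at_top. t * norm (n 0) - norm (?v 0) \<le> norm (?v t)"
        using eventually_ge_at_top[of 0]
      proof eventually_elim
        case (elim t)
        have "norm (t *\<^sub>R n 0) - norm (?v 0) \<le> norm (t *\<^sub>R n 0 + ?v 0)"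
          by (rule norm_diff_ineq)
        then show ?case using elim by (simp add: v[of t] add.commute)
      qed
    qed
    then show ?thesis by (rule curvature_tendsto_0_if_velocity_at_top)
  qed
qed

lemma norm_planar_ode_solution:
  fixes P Q :: "real \<Rightarrow> real"
  assumes "\<And>t. (P has_real_derivative a * P t - b * Q t) (at t)"
    and "\<And>t. (Q has_real_derivative b * P t + a * Q t) (at t)"
  shows "cmod (Complex (P t) (Q t)) = exp (a * t) * cmod (Complex (P 0) (Q 0))"
proof -
  have "((\<lambda>t. Complex (P t) (Q t)) has_vector_derivative Complex a b * Complex (P t) (Q t)) (at t)" for t
    using assms[of t]
    by (simp add: has_vector_derivative_complex_iff has_real_derivative_iff_has_vector_derivative add.commute)
  from norm_linear_ode_solution[OF this, of t] show ?thesis by simp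
qed

lemma cmod_inner_le: "cmod (Complex (p \<bullet> x) (q \<bullet> x)) \<le> (norm p + norm q) * norm x"
proof -
  have "cmod (Complex (p \<bullet> x) (q \<bullet> x)) \<le> \<bar>p \<bullet> x\<bar> + \<bar>q \<bullet> x\<bar>"
    using cmod_le[of "Complex (p \<bullet> x) (q \<bullet> x)"] by simp
  also have "\<dots> \<le> norm p * norm x + norm q * norm x"
    by (intro add_mono Cauchy_Schwarz_ineq2)
  finally show ?thesis by (simp add: algebra_simps)
qed

lemma curvature_tendsto_0_positive_eigenvalue:
  assumes sp: "spectrum3 A j k l" and j: "Re j > 0"
  obtains u where "u \<noteq> 0" "\<And>r0. u \<bullet> r0 \<noteq> 0 \<Longrightarrow> (curvature (trajectory A r0) \<longlongrightarrow> 0) at_top"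
proof -
  obtain p q where pq: "p \<noteq> 0 \<or> q \<noteq> 0"
    and Ap: "transpose A *v p = Re j *\<^sub>R p - Im j *\<^sub>R q"
    and Aq: "transpose A *v q = Im j *\<^sub>R p + Re j *\<^sub>R q"
    using eigenvector_real_parts[of "transpose A" j k l] sp spectrum3_transpose by metis
  have adj: "w \<bullet> (A *v x) = (transpose A *v w) \<bullet> x" for w x
    by (simp add: dot_lmul_matrix)
  have p: "p \<bullet> (A *v x) = Re j * (p \<bullet> x) - Im j * (q \<bullet> x)"
    and q: "q \<bullet> (A *v x) = Im j * (p \<bullet> x) + Re j * (q \<bullet> x)" for x
    unfolding adj Ap Aq by (simp_all add: inner_diff_left inner_add_left)
  have main: "(curvature (trajectory A r0) \<longlongrightarrow> 0) at_top" if r0: "p \<bullet> r0 \<noteq> 0 \<or> q \<bullet> r0 \<noteq> 0" for r0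
  proof -
    let ?v = "velocity A r0"
    let ?F = "\<lambda>t. Complex (p \<bullet> ?v t) (q \<bullet> ?v t)"
    have d: "((\<lambda>t. w \<bullet> ?v t) has_real_derivative w \<bullet> (A *v ?v t)) (at t)" for w t
      unfolding has_real_derivative_iff_has_vector_derivative
      by (rule bounded_linear.has_vector_derivative[OF bounded_linear_inner_right velocity_deriv])
    have F: "cmod (?F t) = exp (Re j * t) * cmod (?F 0)" for t
      by (rule norm_planar_ode_solution[OF d[of p, unfolded p] d[of q, unfolded q]])
    have "?F 0 = j * Complex (p \<bullet> r0) (q \<bullet> r0)"
      by (simp add: velocity_def p q complex_eq_iff)
    moreover have "j \<noteq> 0" using j by auto
    moreover have "Complex (p \<bullet> r0) (q \<bullet> r0) \<noteq> 0" using r0 by (auto simp: complex_eq_iff)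
    ultimately have F0: "?F 0 \<noteq> 0" by (metis mult_eq_0_iff)
    define K where "K = norm p + norm q"
    have K: "K > 0" unfolding K_def using pq by (auto intro: add_pos_nonneg add_nonneg_pos)
    have "filterlim (\<lambda>t. norm (?v t)) at_top at_top"
    proof (rule filterlim_at_top_mono)
      show "filterlim (\<lambda>t. exp (Re j * t) * cmod (?F 0) / K) at_top at_top"
      proof -
        have "cmod (?F 0) > 0" using F0 by simp
        then show ?thesis using j K by real_asymp
      qed
      have "exp (Re j * t) * cmod (?F 0) / K \<le> norm (?v t)" for t
        using cmod_inner_le[of p "?v t" q] K unfolding F[of t] by (simp add: K_def field_simps)
      then show "\<forall>\<^sub>F t in at_top. exp (Re j * t) * cmod (?F 0) / K \<le> norm (?v t)" by simp
    qed
    then show ?thesis by (rule curvature_tendsto_0_if_velocity_at_top)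
  qed
  show ?thesis
  proof (cases "p = 0")
    case True
    then show ?thesis using pq main that[of q] by blast
  next
    case False
    then show ?thesis using main that[of p] by blast
  qed
qed

section \<open>Torsion\<close>

lemma cyclic_orthogonal_zero:
  fixes A :: "real^3^3"
  assumes D: "(v \<times> (A *v v)) \<bullet> (A *v (A *v v)) \<noteq> 0"
    and p: "p \<bullet> (v \<times> (A *v v)) = 0" "(A *v p) \<bullet> (v \<times> (A *v v)) = 0"
      "(A *v (A *v p)) \<bullet> (v \<times> (A *v v)) = 0"
  shows "p = 0"
proof -
  let ?w = "v \<times> (A *v v)" and ?D = "(v \<times> (A *v v)) \<bullet> (A *v (A *v v))"
  obtain a b where 1: "?D *\<^sub>R p = a *\<^sub>R v + b *\<^sub>R (A *v v)"
    using cramer_cross[of v "A *v v" "A *v (A *v v)" p] p(1) by simp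
  have 2: "?D *\<^sub>R (A *v p) = a *\<^sub>R (A *v v) + b *\<^sub>R (A *v (A *v v))"
    using arg_cong[OF 1, of "(*v) A"] by (simp add: algebra_simps matrix_vector_mult_scaleR)
  have "b * ?D = (?D *\<^sub>R (A *v p)) \<bullet> ?w"
    unfolding 2 by (simp add: inner_add_left dot_cross_self inner_commute[of "A *v (A *v v)"])
  also have "\<dots> = 0" using p(2) by simp
  finally have b: "b = 0" using D by simp
  have 3: "?D *\<^sub>R (A *v (A *v p)) = a *\<^sub>R (A *v (A *v v))"
    using arg_cong[OF 2, of "(*v) A"] b by (simp add: algebra_simps matrix_vector_mult_scaleR)
  have "a * ?D = (?D *\<^sub>R (A *v (A *v p))) \<bullet> ?w"
    unfolding 3 by (simp add: inner_commute)
  also have "\<dots> = 0" using p(3) by simp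
  finally have "a = 0" using D by simp
  then show "p = 0" using 1 b D by simp
qed

lemma has_vector_derivative_cross3:
  assumes "(f has_vector_derivative f') (at t)" "(g has_vector_derivative g') (at t)"
  shows "((\<lambda>t. f t \<times> g t) has_vector_derivative f t \<times> g' + f' \<times> g t) (at t)"
  by (rule bounded_bilinear.has_vector_derivative[OF bilinear_cross[unfolded bilinear_conv_bounded_bilinear] assms])

lemma velocity_cross_deriv:
  "((\<lambda>t. velocity A r0 t \<times> (A *v velocity A r0 t)) has_vector_derivative
      velocity A r0 t \<times> (A *v (A *v velocity A r0 t))) (at t)"
  using has_vector_derivative_cross3[OF velocity_deriv[of A r0 t] matrix_velocity_deriv[of A A r0 t]] by simp

lemma velocity_triple_product:
  fixes A r0
  defines "D \<equiv> \<lambda>t. (velocity A r0 t \<times> (A *v velocity A r0 t)) \<bullet> (A *v (A *v velocity A r0 t))"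
  shows "\<bar>D t\<bar> = exp (trace A * t) * \<bar>D 0\<bar>"
proof -
  let ?v = "velocity A r0"
  have d: "((\<lambda>t. A *v (A *v ?v t)) has_vector_derivative A *v (A *v (A *v ?v t))) (at t)" for t
    using matrix_velocity_deriv[of "A ** A" A r0 t] by (simp add: matrix_vector_mul_assoc matrix_mul_assoc)
  have "(D has_real_derivative trace A * D t - 0 * 0) (at t)" for t
    unfolding D_def has_real_derivative_iff_has_vector_derivative
    using bounded_bilinear.has_vector_derivative[OF bounded_bilinear_inner
        velocity_cross_deriv[of A r0 t] d[of t]]
    by (simp add: cayley_hamilton_3 inner_add_right inner_diff_right dot_cross_self)
  then have "cmod (Complex (D t) 0) = exp (trace A * t) * cmod (Complex (D 0) 0)"
    by (intro norm_planar_ode_solution[of D _ 0]) simp_all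
  then show ?thesis by (simp add: complex_norm)
qed

lemma torsion_tendsto_0_small_eigenvalue:
  assumes sp: "spectrum3 A j k l" and j: "2 * Re j < trace A"
  shows "(torsion (trajectory A r0) \<longlongrightarrow> 0) at_top"
proof -
  let ?v = "velocity A r0"
  let ?w = "\<lambda>t. ?v t \<times> (A *v ?v t)"
  let ?D = "\<lambda>t. ?w t \<bullet> (A *v (A *v ?v t))"
  have ev: "\<forall>\<^sub>F t in at_top. ?D t / (norm (?w t))\<^sup>2 = torsion (trajectory A r0) t"
    using eventually_ge_at_top[of 0] by eventually_elim (simp add: torsion_trajectory)
  have D: "\<bar>?D t\<bar> = exp (trace A * t) * \<bar>?D 0\<bar>" for t
    by (rule velocity_triple_product)
  show ?thesis
  proof (cases "?D 0 = 0")
    case True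
    then have "?D t = 0" for t using D[of t] by simp
    then show ?thesis using ev by (intro tendsto_eventually) simp
  next
    case False
    obtain p q where pq: "p \<noteq> 0 \<or> q \<noteq> 0"
      and Ap: "A *v p = Re j *\<^sub>R p - Im j *\<^sub>R q" and Aq: "A *v q = Im j *\<^sub>R p + Re j *\<^sub>R q"
      using eigenvector_real_parts[OF sp] by metis
    let ?F = "\<lambda>t. Complex (p \<bullet> ?w t) (q \<bullet> ?w t)"
    have d: "((\<lambda>t. u \<bullet> ?w t) has_real_derivative trace A * (u \<bullet> ?w t) - (A *v u) \<bullet> ?w t) (at t)" for u t
    proof -
      have "((\<lambda>t. u \<bullet> ?w t) has_real_derivative u \<bullet> (?v t \<times> (A *v (A *v ?v t)))) (at t)"
        unfolding has_real_derivative_iff_has_vector_derivative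
        by (rule bounded_linear.has_vector_derivative[OF bounded_linear_inner_right velocity_cross_deriv])
      moreover have "u \<bullet> (?v t \<times> (A *v (A *v ?v t))) = trace A * (u \<bullet> ?w t) - (A *v u) \<bullet> ?w t"
        using trace_cross_identity[of A u "?v t" "A *v ?v t"] by simp
      ultimately show ?thesis by simp
    qed
    have F: "cmod (?F t) = exp ((trace A - Re j) * t) * cmod (?F 0)" for t
    proof (rule norm_planar_ode_solution)
      show "((\<lambda>t. p \<bullet> ?w t) has_real_derivative
          (trace A - Re j) * (p \<bullet> ?w t) - (- Im j) * (q \<bullet> ?w t)) (at t)" for t
        by (rule DERIV_cong[OF d]) (simp add: Ap inner_diff_left algebra_simps)
      show "((\<lambda>t. q \<bullet> ?w t) has_real_derivative
          (- Im j) * (p \<bullet> ?w t) + (trace A - Re j) * (q \<bullet> ?w t)) (at t)" for t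
        by (rule DERIV_cong[OF d]) (simp add: Aq inner_add_left algebra_simps)
    qed
    have F0: "?F 0 \<noteq> 0"
    proof
      assume "?F 0 = 0"
      then have 0: "p \<bullet> ?w 0 = 0" "q \<bullet> ?w 0 = 0" by (auto simp: complex_eq_iff)
      then have 1: "(A *v p) \<bullet> ?w 0 = 0" "(A *v q) \<bullet> ?w 0 = 0"
        by (auto simp: Ap Aq inner_diff_left inner_add_left)
      then have 2: "(A *v (A *v p)) \<bullet> ?w 0 = 0" "(A *v (A *v q)) \<bullet> ?w 0 = 0"
        unfolding Ap Aq
        by (simp_all add: matrix_vector_right_distrib matrix_vector_mult_diff_distrib
            matrix_vector_mult_scaleR inner_diff_left inner_add_left Ap Aq 0)
      show False using cyclic_orthogonal_zero[OF False] 0 1 2 pq by blast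
    qed
    define c where "c = cmod (?F 0)"
    define K where "K = norm p + norm q"
    have K: "K > 0" unfolding K_def using pq by (auto intro: add_pos_nonneg add_nonneg_pos)
    have c: "c > 0" using F0 by (simp add: c_def)
    define \<delta> where "\<delta> = trace A - 2 * Re j"
    have \<delta>: "\<delta> > 0" using j by (simp add: \<delta>_def)
    have le: "norm (?D t / (norm (?w t))\<^sup>2) \<le> \<bar>?D 0\<bar> * K\<^sup>2 / c\<^sup>2 * exp (- (\<delta> * t))" for t
    proof -
      let ?g = "exp ((trace A - Re j) * t) * c / K"
      have g: "?g > 0" using c K by simp
      have "?g \<le> norm (?w t)"
        using cmod_inner_le[of p "?w t" q] K unfolding F[of t] by (simp add: K_def c_def field_simps)
      then have "?g\<^sup>2 \<le> (norm (?w t))\<^sup>2" using g by (intro power_mono) auto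
      moreover have "?g\<^sup>2 > 0" by (rule zero_less_power[OF g])
      ultimately have "\<bar>?D t\<bar> / (norm (?w t))\<^sup>2 \<le> \<bar>?D t\<bar> / ?g\<^sup>2"
        by (intro divide_left_mono mult_pos_pos) linarith+
      then have "norm (?D t / (norm (?w t))\<^sup>2) \<le> \<bar>?D t\<bar> / ?g\<^sup>2"
        by simp
      also have "\<dots> = \<bar>?D 0\<bar> * K\<^sup>2 / c\<^sup>2 * (exp (trace A * t) / (exp ((trace A - Re j) * t))\<^sup>2)"
        unfolding D[of t] by (simp add: power_mult_distrib power_divide field_simps)
      also have "exp (trace A * t) / (exp ((trace A - Re j) * t))\<^sup>2 = exp (- (\<delta> * t))"
        unfolding \<delta>_def by (simp add: power2_eq_square algebra_simps flip: exp_diff exp_add)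
      finally show ?thesis .
    qed
    have "((\<lambda>t. \<bar>?D 0\<bar> * K\<^sup>2 / c\<^sup>2 * exp (- (\<delta> * t))) \<longlongrightarrow> 0) at_top"
      by (rule tendsto_mult_right_zero) (use \<delta> in real_asymp)
    then have "((\<lambda>t. ?D t / (norm (?w t))\<^sup>2) \<longlongrightarrow> 0) at_top"
      by (rule Lim_null_comparison[rotated]) (use le in simp)
    then show ?thesis using tendsto_cong[OF ev] by simp
  qed
qed

lemma torsion_tendsto_0_singular:
  assumes "det A = 0"
  shows "(torsion (trajectory A r0) \<longlongrightarrow> 0) at_top"
proof (rule tendsto_eventually)
  have det: "((A *v x) \<times> (A *v y)) \<bullet> (A *v z) = det A * ((x \<times> y) \<bullet> z)" for x y z :: "real^3"
    using cross_matrix_mult[of A x y]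
    by (metis dot_lmul_matrix inner_commute inner_scaleR_left transpose_matrix_vector transpose_transpose)
  show "\<forall>\<^sub>F t in at_top. torsion (trajectory A r0) t = 0"
    using eventually_ge_at_top[of 0]
    by eventually_elim (simp add: torsion_trajectory velocity_def det assms)
qed

section \<open>Stability criteria\<close>

lemma zero_asymptotically_stable_if_torsion:
  assumes "\<not> (torsion (trajectory A r0) \<longlongrightarrow> 0) at_top"
  shows "zero_asymptotically_stable A"
proof -
  have ge: "2 * Re j \<ge> trace A" if "spectrum3 A j k l" for j k l
    using torsion_tendsto_0_small_eigenvalue[OF that] assms by force
  have det: "det A \<noteq> 0" using torsion_tendsto_0_singular assms by blast
  show ?thesis
  proof (cases A rule: spectrum3_cases)
    case (1 a b c)
    then have T: "trace A = a + b + c" and d: "det A = a * b * c"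
      unfolding spectrum3_def by (simp_all only: of_real_eq_iff flip: of_real_add of_real_mult)
    have "2 * c \<ge> trace A"
      using ge[OF spectrum3_rotate[OF spectrum3_rotate[OF 1(1)]]] by simp
    moreover have "a \<noteq> 0" using d det by auto
    ultimately have "a < 0" "b < 0" "c < 0" using 1(2,3) T by linarith+
    then show ?thesis
      using trajectory_tendsto_0[OF 1(1)] by (intro zero_asymptotically_stable_if_tendsto_0) simp
  next
    case (2 \<mu> \<alpha> \<beta>)
    then have "complex_of_real (trace A) = complex_of_real (\<mu> + 2 * \<alpha>)"
      "complex_of_real (det A) = complex_of_real (\<mu> * (\<alpha>\<^sup>2 + \<beta>\<^sup>2))"
      unfolding spectrum3_def by (auto simp: complex_eq_iff power2_eq_square algebra_simps)
    then have T: "trace A = \<mu> + 2 * \<alpha>" and d: "det A = \<mu> * (\<alpha>\<^sup>2 + \<beta>\<^sup>2)"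
      by (simp_all only: of_real_eq_iff)
    have "2 * \<mu> \<ge> trace A" using ge[OF 2(1)] by simp
    moreover have "2 * \<alpha> \<ge> trace A" using ge[OF spectrum3_rotate[OF 2(1)]] by simp
    moreover have "\<mu> \<noteq> 0" using d det by auto
    ultimately have "\<mu> < 0" "\<alpha> < 0" using T by linarith+
    then show ?thesis
      using trajectory_tendsto_0[OF 2(1)] by (intro zero_asymptotically_stable_if_tendsto_0) simp
  qed
qed

lemma zero_asymptotically_stable_if_curvature_at_top:
  assumes inv: "invertible A" and E: "E \<in> sets lebesgue" "emeasure lebesgue E > 0"
    and lim: "\<And>r0. r0 \<in> E \<Longrightarrow> filterlim (curvature (trajectory A r0)) at_top at_top"
  shows "zero_asymptotically_stable A"
proof -
  define S where "S = {r0. (trajectory A r0 \<longlongrightarrow> 0) at_top}"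
  obtain B where B: "B ** A = mat 1" using inv by (auto simp: invertible_def)
  have "E \<subseteq> S"
  proof
    fix r0 assume "r0 \<in> E"
    then have v: "(velocity A r0 \<longlongrightarrow> 0) at_top"
      using lim velocity_tendsto_0_if_curvature_at_top by blast
    have "((\<lambda>t. B *v velocity A r0 t) \<longlongrightarrow> B *v 0) at_top"
      by (rule bounded_linear.tendsto[OF _ v]) simp
    moreover have "(\<lambda>t. B *v velocity A r0 t) = trajectory A r0"
      by (simp add: velocity_def matrix_vector_mul_assoc B)
    ultimately show "r0 \<in> S" by (simp add: S_def)
  qed
  have "subspace S"
  proof (rule subspaceI)
    show "0 \<in> S" by (simp add: S_def trajectory_def[abs_def])
    show "x + y \<in> S" if "x \<in> S" "y \<in> S" for x y
      using that tendsto_add[of "trajectory A x" 0 _ "trajectory A y" 0]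
      by (simp add: S_def trajectory_def[abs_def] matrix_vector_right_distrib)
    show "c *\<^sub>R x \<in> S" if "x \<in> S" for c x
      using that tendsto_scaleR[OF tendsto_const, of "trajectory A x" 0 _ c]
      by (simp add: S_def trajectory_def[abs_def] matrix_vector_mult_scaleR)
  qed
  have "S = UNIV"
  proof (rule ccontr)
    assume "S \<noteq> UNIV"
    with \<open>subspace S\<close> have "dim S < DIM(real^3)"
      by (metis dim_eq_full dim_subset_UNIV le_neq_implies_less span_eq_iff)
    then have "negligible E"
      using \<open>E \<subseteq> S\<close> negligible_lowdim negligible_subset by blast
    then show False using E by (simp add: negligible_iff_emeasure0)
  qed
  then show ?thesis by (intro zero_asymptotically_stable_if_tendsto_0) (auto simp: S_def)
qed

lemma zero_stable_if_curvature:
  assumes E: "E \<in> sets lebesgue" "emeasure lebesgue E > 0"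
    and lim: "\<And>r0. r0 \<in> E \<Longrightarrow> \<not> (curvature (trajectory A r0) \<longlongrightarrow> 0) at_top"
  shows "zero_stable A"
proof -
  have le: "Re j \<le> 0" if sp: "spectrum3 A j k l" for j k l
  proof (rule ccontr)
    assume "\<not> Re j \<le> 0"
    then obtain u where "u \<noteq> 0" "\<And>r0. u \<bullet> r0 \<noteq> 0 \<Longrightarrow> (curvature (trajectory A r0) \<longlongrightarrow> 0) at_top"
      using curvature_tendsto_0_positive_eigenvalue[OF sp] by (metis not_le)
    then have "E \<subseteq> {x. u \<bullet> x = 0}" using lim by blast
    then have "negligible E"
      using negligible_hyperplane[of u 0] \<open>u \<noteq> 0\<close> negligible_subset by blast
    then show False using E by (simp add: negligible_iff_emeasure0)
  qed
  obtain r0 where "r0 \<in> E" using E by fastforce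
  show ?thesis
  proof (cases A rule: spectrum3_cases)
    case (1 a b c)
    have "a \<le> 0" using le[OF 1(1)] by simp
    then consider "a < 0" | "a = 0" "b < 0" | "a = 0" "b = 0" using 1 by linarith
    then show ?thesis
    proof cases
      case 1
      then have "(trajectory A r0 \<longlongrightarrow> 0) at_top" for r0
        using \<open>a \<ge> b\<close> \<open>b \<ge> c\<close>
        by (intro trajectory_tendsto_0[OF \<open>spectrum3 A (of_real a) (of_real b) (of_real c)\<close>]) auto
      then show ?thesis
        using zero_asymptotically_stable_if_tendsto_0 zero_asymptotically_stable_def by blast
    next
      case 2
      then show ?thesis
        using \<open>b \<ge> c\<close> \<open>spectrum3 A (of_real a) (of_real b) (of_real c)\<close>
        by (intro zero_stable_if_bounded bounded_trajectory_simple_zero[of A b c]) auto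
    next
      case 3
      then have "(curvature (trajectory A r0) \<longlongrightarrow> 0) at_top"
        using \<open>b \<ge> c\<close> \<open>spectrum3 A (of_real a) (of_real b) (of_real c)\<close>
        by (intro curvature_tendsto_0_double_zero[of A c]) auto
      then show ?thesis using lim \<open>r0 \<in> E\<close> by blast
    qed
  next
    case (2 \<mu> \<alpha> \<beta>)
    have "\<mu> \<le> 0" "\<alpha> \<le> 0" using le[OF 2(1)] le[OF spectrum3_rotate[OF 2(1)]] by auto
    then show ?thesis
      using 2(2) by (intro zero_stable_if_bounded bounded_trajectory_distinct[OF 2(1)])
        (auto simp: complex_eq_iff)
  qed
qed

theorem theorem1p2:
  fixes A :: "real^3^3"
  shows
    "((\<exists>E1 \<in> sets (lebesgue :: (real^3) measure). emeasure lebesgue E1 > 0 \<and>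
        (\<forall>r0\<in>E1. \<not> (curvature (trajectory A r0) \<longlongrightarrow> 0) at_top))
      \<longrightarrow> zero_stable A)
   \<and> (invertible A \<and>
      (\<exists>E2 \<in> sets (lebesgue :: (real^3) measure). emeasure lebesgue E2 > 0 \<and>
        (\<forall>r0\<in>E2. filterlim (curvature (trajectory A r0)) at_top at_top))
      \<longrightarrow> zero_asymptotically_stable A)
   \<and> ((\<exists>E3 \<in> sets (lebesgue :: (real^3) measure). emeasure lebesgue E3 > 0 \<and>
        (\<forall>r0\<in>E3. \<not> (torsion (trajectory A r0) \<longlongrightarrow> 0) at_top))
      \<longrightarrow> zero_asymptotically_stable A)"
proof (intro conjI impI; (elim conjE bexE)?)
  fix E assume "E \<in> sets (lebesgue :: (real^3) measure)" "emeasure lebesgue E > 0"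
    "\<forall>r0\<in>E. \<not> (curvature (trajectory A r0) \<longlongrightarrow> 0) at_top"
  then show "zero_stable A" using zero_stable_if_curvature by blast
next
  fix E assume "invertible A" "E \<in> sets (lebesgue :: (real^3) measure)" "emeasure lebesgue E > 0"
    "\<forall>r0\<in>E. filterlim (curvature (trajectory A r0)) at_top at_top"
  then show "zero_asymptotically_stable A"
    using zero_asymptotically_stable_if_curvature_at_top by blast
next
  fix E assume E: "E \<in> sets (lebesgue :: (real^3) measure)" "emeasure lebesgue E > 0"
    "\<forall>r0\<in>E. \<not> (torsion (trajectory A r0) \<longlongrightarrow> 0) at_top"
  then obtain r0 where "r0 \<in> E" by fastforce
  with E show "zero_asymptotically_stable A"
    using zero_asymptotically_stable_if_torsion by blast
qed

end
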